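(* Let $\mathcal{P}$ and $\mathcal{B}$ be finite sets of atomic program and test symbols, let $H:\mathrm{Rex}_{\mathcal{P},\mathcal{B}}\to\mathrm{Rex}_{\mathcal{P},\mathcal{B}}$ be an idempotent syntactic homomorphism, and let $E$ be a set of equations between terms of $\mathrm{Rex}_{\mathcal{P},\mathcal{B}}$. Let $H(E)=\{H(r)=H(r') : (r=r')\in E\}$. Then for any $s,t\in\mathrm{Rex}_{\mathcal{P},\mathcal{B}}$ and any Kleene algebra with tests $K$, $$K\models E\wedge E_H\rightarrow s=t \iff K\models H(E)\rightarrow H(s)=H(t).$$
   Context: A Kleene algebra with tests (KAT) is a two-sorted structure $(K,B,+,\cdot,{}^*,\overline{\phantom{x}},0,1)$ where $(K,+,\cdot,{}^*,0,1)$ is a Kleene algebra (an idempotent semiring with partial order $x\le y:\iff x+y=y$ satisfying $1+xx^*\le x^*$, $1+x^*x\le x^*$, $p+qx\le x\rightarrow q^*p\le x$, $p+xq\le x\rightarrow pq^*\le x$) and $B\subseteq K$ with $(B,+,\cdot,\overline{\phantom{x}},0,1)$ a Boolean algebra of tests; $\mathsf{KAT}$ is the class of all KATs. $\mathrm{Rex}_{\mathcal{P},\mathcal{B}}$ is the set of KAT terms over atomic programs $\mathcal{P}$ and atomic tests $\mathcal{B}$ (negation applied only to Boolean terms, i.e., terms built from atomic tests, $0,1,+,\cdot$, negation). An interpretation into a KAT $K$ is a map $I:\mathrm{Rex}_{\mathcal{P},\mathcal{B}}\to K$ that respects all operations and sends atomic tests to tests. A map $H:\mathrm{Rex}_{\mathcal{P},\mathcal{B}}\to\mathrm{Rex}_{\mathcal{P},\mathcal{B}}$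 is a syntactic homomorphism if for every KAT $K$ and every interpretation $I$ into $K$, $I\circ H$ is also an interpretation; it is idempotent if $\mathsf{KAT}\models H(r)=H(H(r))$ for all terms $r$. $E_H$ denotes $\{p=H(p): p\in\mathcal{P}\}\cup\{b=H(b): b\in\mathcal{B}\}$. For a set of equations $F$, $K\models F\rightarrow s=t$ means: for every interpretation $I$ into $K$ satisfying all equations in $F$, $I(s)=I(t)$. *)

theory Defs
  imports "HOL-Algebra.Ring"
begin

record 'a kat = "'a ring" +
  star :: "'a \<Rightarrow> 'a"
  tests :: "'a set"
  neg :: "'a \<Rightarrow> 'a"

definition kle :: "('a, 'm) ring_scheme \<Rightarrow> 'a \<Rightarrow> 'a \<Rightarrow> bool" (infix \<open>\<sqsubseteq>\<index>\<close> 50)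
  where "x \<sqsubseteq>\<^bsub>K\<^esub> y \<longleftrightarrow> x \<oplus>\<^bsub>K\<^esub> y = y"

locale kleene_algebra = semiring K for K :: "('a, 'm) kat_scheme" (structure) +
  assumes add_idem: "x \<in> carrier K \<Longrightarrow> x \<oplus> x = x"
    and star_closed: "x \<in> carrier K \<Longrightarrow> star K x \<in> carrier K"
    and star_unfold_left: "x \<in> carrier K \<Longrightarrow> \<one> \<oplus> x \<otimes> star K x \<sqsubseteq> star K x"
    and star_unfold_right: "x \<in> carrier K \<Longrightarrow> \<one> \<oplus> star K x \<otimes> x \<sqsubseteq> star K x"
    and star_induct_left:
      "\<lbrakk>p \<in> carrier K; q \<in> carrier K; x \<in> carrier K; p \<oplus> q \<otimes> x \<sqsubseteq> x\<rbrakk> \<Longrightarrow> star K q \<otimes> p \<sqsubseteq> x"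
    and star_induct_right:
      "\<lbrakk>p \<in> carrier K; q \<in> carrier K; x \<in> carrier K; p \<oplus> x \<otimes> q \<sqsubseteq> x\<rbrakk> \<Longrightarrow> p \<otimes> star K q \<sqsubseteq> x"

text \<open>Huntington's axioms for a Boolean algebra with carrier \<open>A\<close>, join \<open>j\<close>, meet \<open>m\<close>,
  complement \<open>c\<close>, bottom \<open>z\<close> and top \<open>u\<close>.  The degenerate case \<open>z = u\<close> is allowed.\<close>

locale boolean_algebra_on =
  fixes A :: "'a set" and j :: "'a \<Rightarrow> 'a \<Rightarrow> 'a" and m :: "'a \<Rightarrow> 'a \<Rightarrow> 'a"
    and c :: "'a \<Rightarrow> 'a" and z :: 'a and u :: 'a
  assumes join_closed: "\<lbrakk>a \<in> A; b \<in> A\<rbrakk> \<Longrightarrow> j a b \<in> A"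
    and meet_closed: "\<lbrakk>a \<in> A; b \<in> A\<rbrakk> \<Longrightarrow> m a b \<in> A"
    and compl_closed: "a \<in> A \<Longrightarrow> c a \<in> A"
    and bot_closed: "z \<in> A"
    and top_closed: "u \<in> A"
    and join_commute: "\<lbrakk>a \<in> A; b \<in> A\<rbrakk> \<Longrightarrow> j a b = j b a"
    and meet_commute: "\<lbrakk>a \<in> A; b \<in> A\<rbrakk> \<Longrightarrow> m a b = m b a"
    and join_meet_distrib: "\<lbrakk>a \<in> A; b \<in> A; d \<in> A\<rbrakk> \<Longrightarrow> j a (m b d) = m (j a b) (j a d)"
    and meet_join_distrib: "\<lbrakk>a \<in> A; b \<in> A; d \<in> A\<rbrakk> \<Longrightarrow> m a (j b d) = j (m a b) (m a d)"
    and join_bot: "a \<in> A \<Longrightarrow> j a z = a"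
    and meet_top: "a \<in> A \<Longrightarrow> m a u = a"
    and join_compl: "a \<in> A \<Longrightarrow> j a (c a) = u"
    and meet_compl: "a \<in> A \<Longrightarrow> m a (c a) = z"

locale kat = kleene_algebra K for K :: "('a, 'm) kat_scheme" (structure) +
  assumes tests_subset: "tests K \<subseteq> carrier K"
    and tests_boolean: "boolean_algebra_on (tests K) (add K) (mult K) (neg K) \<zero> \<one>"

datatype ('p, 'b) kterm =
    Prog 'p
  | Test 'b
  | Zero
  | One
  | Plus "('p, 'b) kterm" "('p, 'b) kterm"
  | Times "('p, 'b) kterm" "('p, 'b) kterm"
  | Star "('p, 'b) kterm"
  | Neg "('p, 'b) kterm"

inductive_set Bterm :: "'b set \<Rightarrow> ('p, 'b) kterm set" for B :: "'b set" where
  "b \<in> B \<Longrightarrow> Test b \<in> Bterm B"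
| "Zero \<in> Bterm B"
| "One \<in> Bterm B"
| "\<lbrakk>r \<in> Bterm B; s \<in> Bterm B\<rbrakk> \<Longrightarrow> Plus r s \<in> Bterm B"
| "\<lbrakk>r \<in> Bterm B; s \<in> Bterm B\<rbrakk> \<Longrightarrow> Times r s \<in> Bterm B"
| "r \<in> Bterm B \<Longrightarrow> Neg r \<in> Bterm B"

inductive_set Rex :: "'p set \<Rightarrow> 'b set \<Rightarrow> ('p, 'b) kterm set"
  for P :: "'p set" and B :: "'b set" where
  "p \<in> P \<Longrightarrow> Prog p \<in> Rex P B"
| "b \<in> B \<Longrightarrow> Test b \<in> Rex P B"
| "Zero \<in> Rex P B"
| "One \<in> Rex P B"
| "\<lbrakk>r \<in> Rex P B; s \<in> Rex P B\<rbrakk> \<Longrightarrow> Plus r s \<in> Rex P B"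
| "\<lbrakk>r \<in> Rex P B; s \<in> Rex P B\<rbrakk> \<Longrightarrow> Times r s \<in> Rex P B"
| "r \<in> Rex P B \<Longrightarrow> Star r \<in> Rex P B"
| "r \<in> Bterm B \<Longrightarrow> Neg r \<in> Rex P B"

text \<open>Values of \<open>I\<close> outside \<open>Rex P B\<close> are irrelevant.\<close>

definition interp ::
    "'p set \<Rightarrow> 'b set \<Rightarrow> 'k kat \<Rightarrow> (('p, 'b) kterm \<Rightarrow> 'k) \<Rightarrow> bool" where
  "interp P B K I \<longleftrightarrow>
     I \<in> Rex P B \<rightarrow> carrier K \<and>
     (\<forall>b\<in>B. I (Test b) \<in> tests K) \<and>
     I Zero = \<zero>\<^bsub>K\<^esub> \<and>
     I One = \<one>\<^bsub>K\<^esub> \<and>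
     (\<forall>r\<in>Rex P B. \<forall>s\<in>Rex P B. I (Plus r s) = I r \<oplus>\<^bsub>K\<^esub> I s) \<and>
     (\<forall>r\<in>Rex P B. \<forall>s\<in>Rex P B. I (Times r s) = I r \<otimes>\<^bsub>K\<^esub> I s) \<and>
     (\<forall>r\<in>Rex P B. I (Star r) = star K (I r)) \<and>
     (\<forall>r\<in>Bterm B. I (Neg r) = neg K (I r))"

text \<open>An equation \<open>r = r'\<close> is represented by the pair \<open>(r, r')\<close>;
  \<open>models_imp P B K F s t\<close> is $K \models F \rightarrow s = t$.\<close>

definition models_imp ::
    "'p set \<Rightarrow> 'b set \<Rightarrow> 'k kat \<Rightarrow> (('p, 'b) kterm \<times> ('p, 'b) kterm) set \<Rightarrow>
     ('p, 'b) kterm \<Rightarrow> ('p, 'b) kterm \<Rightarrow> bool" where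
  "models_imp P B K F s t \<longleftrightarrow>
     (\<forall>I. interp P B K I \<and> (\<forall>(r, r')\<in>F. I r = I r') \<longrightarrow> I s = I t)"

text \<open>HOL cannot quantify over all types inside a formula, so in the next two definitions
  ``every KAT'' ranges over the KATs whose carrier is a set of elements of the type of terms.
  This is no restriction: every interpretation into a KAT factors through a sub-KAT that has at
  most as many elements as there are terms.  The lemmas \<open>syntactic_hom_all_kats\<close> and
  \<open>KAT_valid_all_kats\<close> below prove that both notions entail the corresponding property for KATs
  over an arbitrary type.\<close>

definition syntactic_hom ::
    "'p set \<Rightarrow> 'b set \<Rightarrow> (('p, 'b) kterm \<Rightarrow> ('p, 'b) kterm) \<Rightarrow> bool" where
  "syntactic_hom P B H \<longleftrightarrow>
     H \<in> Rex P B \<rightarrow> Rex P B \<and>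
     (\<forall>(K :: ('p, 'b) kterm kat) I. kat K \<and> interp P B K I \<longrightarrow> interp P B K (I \<circ> H))"

definition KAT_valid ::
    "'p set \<Rightarrow> 'b set \<Rightarrow> ('p, 'b) kterm \<Rightarrow> ('p, 'b) kterm \<Rightarrow> bool" where
  "KAT_valid P B s t \<longleftrightarrow>
     (\<forall>(K :: ('p, 'b) kterm kat) I. kat K \<and> interp P B K I \<longrightarrow> I s = I t)"

definition idempotent_hom ::
    "'p set \<Rightarrow> 'b set \<Rightarrow> (('p, 'b) kterm \<Rightarrow> ('p, 'b) kterm) \<Rightarrow> bool" where
  "idempotent_hom P B H \<longleftrightarrow> (\<forall>r\<in>Rex P B. KAT_valid P B (H r) (H (H r)))"

definition E_hom ::
    "'p set \<Rightarrow> 'b set \<Rightarrow> (('p, 'b) kterm \<Rightarrow> ('p, 'b) kterm) \<Rightarrow>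
     (('p, 'b) kterm \<times> ('p, 'b) kterm) set" where
  "E_hom P B H = {(Prog p, H (Prog p)) | p. p \<in> P} \<union> {(Test b, H (Test b)) | b. b \<in> B}"

definition image_eqs ::
    "(('p, 'b) kterm \<Rightarrow> ('p, 'b) kterm) \<Rightarrow> (('p, 'b) kterm \<times> ('p, 'b) kterm) set \<Rightarrow>
     (('p, 'b) kterm \<times> ('p, 'b) kterm) set" where
  "image_eqs H E = {(H r, H r') | r r'. (r, r') \<in> E}"

lemma Bterm_subset_Rex: "Bterm B \<subseteq> Rex P B"
proof
  fix r :: "('a, 'b) kterm" assume "r \<in> Bterm B"
  then show "r \<in> Rex P B" by induction (auto intro: Rex.intros)
qed

lemma interp_Bterm_tests:
  assumes "kat K" "interp P B K I" "r \<in> Bterm B"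
  shows "I r \<in> tests K"
proof -
  interpret kat K by fact
  interpret T: boolean_algebra_on "tests K" "add K" "mult K" "neg K" "\<zero>\<^bsub>K\<^esub>" "\<one>\<^bsub>K\<^esub>"
    by (rule tests_boolean)
  have sub: "x \<in> Bterm B \<Longrightarrow> x \<in> Rex P B" for x using Bterm_subset_Rex by blast
  show ?thesis
    using assms(3) assms(2)
    by induction
      (auto simp: interp_def sub T.join_closed T.meet_closed T.compl_closed T.bot_closed T.top_closed)
qed

text \<open>Copy into the type of terms of the sub-KAT generated by an interpretation.\<close>

lemma term_kat_factor:
  fixes K :: "'k kat" and I :: "('p, 'b) kterm \<Rightarrow> 'k"
  assumes K: "kat K" and I: "interp P B K I"
  obtains K' :: "('p, 'b) kterm kat" and f
  where "kat K'" "interp P B K' (f \<circ> I)" "\<And>r. r \<in> Rex P B \<Longrightarrow> I (f (I r)) = I r"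
    "\<And>x. x \<in> tests K' \<Longrightarrow> I x \<in> tests K"
    "I \<zero>\<^bsub>K'\<^esub> = \<zero>\<^bsub>K\<^esub>" "I \<one>\<^bsub>K'\<^esub> = \<one>\<^bsub>K\<^esub>"
    "\<And>x y. x \<in> carrier K' \<Longrightarrow> y \<in> carrier K' \<Longrightarrow> I (x \<oplus>\<^bsub>K'\<^esub> y) = I x \<oplus>\<^bsub>K\<^esub> I y"
    "\<And>x y. x \<in> carrier K' \<Longrightarrow> y \<in> carrier K' \<Longrightarrow> I (x \<otimes>\<^bsub>K'\<^esub> y) = I x \<otimes>\<^bsub>K\<^esub> I y"
    "\<And>x. x \<in> carrier K' \<Longrightarrow> I (star K' x) = star K (I x)"
    "\<And>x. x \<in> tests K' \<Longrightarrow> I (neg K' x) = neg K (I x)"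
proof -
  interpret kat K by fact
  interpret T: boolean_algebra_on "tests K" "add K" "mult K" "neg K" "\<zero>\<^bsub>K\<^esub>" "\<one>\<^bsub>K\<^esub>"
    by (rule tests_boolean)
  let ?R = "Rex P B"
  define f where "f = inv_into ?R I"
  have Iz: "I Zero = \<zero>\<^bsub>K\<^esub>" and Io: "I One = \<one>\<^bsub>K\<^esub>"
    and Ip: "\<And>r s. r \<in> ?R \<Longrightarrow> s \<in> ?R \<Longrightarrow> I (Plus r s) = I r \<oplus>\<^bsub>K\<^esub> I s"
    and It: "\<And>r s. r \<in> ?R \<Longrightarrow> s \<in> ?R \<Longrightarrow> I (Times r s) = I r \<otimes>\<^bsub>K\<^esub> I s"
    and Is: "\<And>r. r \<in> ?R \<Longrightarrow> I (Star r) = star K (I r)"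
    and In: "\<And>r. r \<in> Bterm B \<Longrightarrow> I (Neg r) = neg K (I r)"
    and Ic: "\<And>r. r \<in> ?R \<Longrightarrow> I r \<in> carrier K"
    using I by (auto simp: interp_def)
  have sub: "x \<in> Bterm B \<Longrightarrow> x \<in> ?R" for x using Bterm_subset_Rex by blast
  have fR: "r \<in> ?R \<Longrightarrow> f (I r) \<in> ?R" for r
    by (simp add: f_def inv_into_into)
  have If: "r \<in> ?R \<Longrightarrow> I (f (I r)) = I r" for r
    by (simp add: f_def f_inv_into_f)
  define C where "C = (f \<circ> I) ` ?R"
  define T where "T = (f \<circ> I) ` Bterm B"
  define K' :: "('p, 'b) kterm kat" where
    "K' = \<lparr>carrier = C, mult = \<lambda>x y. f (I (Times x y)), one = f (I One), zero = f (I Zero),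
           add = \<lambda>x y. f (I (Plus x y)), star = \<lambda>x. f (I (Star x)),
           tests = T, neg = \<lambda>x. f (neg K (I x))\<rparr>"
  have CR: "x \<in> C \<Longrightarrow> x \<in> ?R" for x by (auto simp: C_def fR)
  have fC: "r \<in> ?R \<Longrightarrow> f (I r) \<in> C" for r by (auto simp: C_def)
  have fT: "r \<in> Bterm B \<Longrightarrow> f (I r) \<in> T" for r by (auto simp: T_def)
  have TC: "T \<subseteq> C" by (auto simp: T_def C_def sub)
  have idC: "x \<in> C \<Longrightarrow> f (I x) = x" for x by (auto simp: C_def If)
  have CI: "x \<in> C \<Longrightarrow> I x \<in> carrier K" for x using CR Ic by blast
  have TB: "\<exists>r\<in>Bterm B. x = f (I r) \<and> I x = I r" if "x \<in> T" for x
    using that by (auto simp: T_def If sub)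
  have TI: "x \<in> T \<Longrightarrow> I x \<in> tests K" for x
    using TB interp_Bterm_tests[OF K I] by metis
  have Cp: "x \<in> C \<Longrightarrow> y \<in> C \<Longrightarrow> f (I (Plus x y)) \<in> C" for x y
    by (intro fC Rex.intros CR)
  have Ct: "x \<in> C \<Longrightarrow> y \<in> C \<Longrightarrow> f (I (Times x y)) \<in> C" for x y
    by (intro fC Rex.intros CR)
  have Cs: "x \<in> C \<Longrightarrow> f (I (Star x)) \<in> C" for x
    by (intro fC Rex.intros CR)
  have Cz: "f (I Zero) \<in> C" and Co: "f (I One) \<in> C"
    by (intro fC Rex.intros)+
  have Vp: "x \<in> C \<Longrightarrow> y \<in> C \<Longrightarrow> I (f (I (Plus x y))) = I x \<oplus>\<^bsub>K\<^esub> I y" for x y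
    by (rule trans[OF If Ip]) (simp_all add: Rex.intros CR)
  have Vt: "x \<in> C \<Longrightarrow> y \<in> C \<Longrightarrow> I (f (I (Times x y))) = I x \<otimes>\<^bsub>K\<^esub> I y" for x y
    by (rule trans[OF If It]) (simp_all add: Rex.intros CR)
  have Vs: "x \<in> C \<Longrightarrow> I (f (I (Star x))) = star K (I x)" for x
    by (rule trans[OF If Is]) (simp_all add: Rex.intros CR)
  have Vz: "I (f (I Zero)) = \<zero>\<^bsub>K\<^esub>" and Vo: "I (f (I One)) = \<one>\<^bsub>K\<^esub>"
    using trans[OF If Iz] trans[OF If Io] Rex.intros(3,4) by blast+
  have Tn: "f (neg K (I x)) \<in> T \<and> I (f (neg K (I x))) = neg K (I x)" if x: "x \<in> T" for x
  proof -
    obtain r where r: "r \<in> Bterm B" "I x = I r" using TB[OF x] by blast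
    then have eq: "neg K (I x) = I (Neg r)" by (simp add: In)
    have "Neg r \<in> Bterm B" using r by (intro Bterm.intros)
    then show ?thesis unfolding eq by (simp add: fT If sub)
  qed
  have Tp: "f (I (Plus x y)) \<in> T" if xy: "x \<in> T" "y \<in> T" for x y
  proof -
    obtain r s where r: "r \<in> Bterm B" "I x = I r" and s: "s \<in> Bterm B" "I y = I s"
      using TB xy by meson
    have "I (Plus x y) = I (Plus r s)" using r s xy TC by (simp add: Ip sub CR subsetD)
    then show ?thesis using r s by (simp add: fT Bterm.intros)
  qed
  have Tt: "f (I (Times x y)) \<in> T" if xy: "x \<in> T" "y \<in> T" for x y
  proof -
    obtain r s where r: "r \<in> Bterm B" "I x = I r" and s: "s \<in> Bterm B" "I y = I s"
      using TB xy by meson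
    have "I (Times x y) = I (Times r s)" using r s xy TC by (simp add: It sub CR subsetD)
    then show ?thesis using r s by (simp add: fT Bterm.intros)
  qed
  have injC: "x = y" if "x \<in> C" "y \<in> C" "I x = I y" for x y
    using that idC by metis
  note V = Vp Vt Vs Vz Vo Cp Ct Cs Cz Co CI
  have K's: "carrier K' = C" "mult K' = (\<lambda>x y. f (I (Times x y)))" "one K' = f (I One)"
    "zero K' = f (I Zero)" "add K' = (\<lambda>x y. f (I (Plus x y)))"
    "star K' = (\<lambda>x. f (I (Star x)))" "tests K' = T" "neg K' = (\<lambda>x. f (neg K (I x)))"
    by (simp_all add: K'_def)
  have bool: "boolean_algebra_on T (\<lambda>x y. f (I (Plus x y))) (\<lambda>x y. f (I (Times x y)))
      (\<lambda>x. f (neg K (I x))) (f (I Zero)) (f (I One))"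
  proof (unfold_locales, goal_cases)
    case (8 a b d)
    with TC have "a \<in> C" "b \<in> C" "d \<in> C" by auto
    with 8 show ?case by (intro injC) (simp_all add: V TI T.join_meet_distrib)
  next
    case (9 a b d)
    with TC have "a \<in> C" "b \<in> C" "d \<in> C" by auto
    with 9 show ?case by (intro injC) (simp_all add: V TI T.meet_join_distrib)
  next
    case (6 a b)
    with TC have "a \<in> C" "b \<in> C" by auto
    with 6 show ?case by (intro injC) (simp_all add: V TI T.join_commute)
  next
    case (7 a b)
    with TC have "a \<in> C" "b \<in> C" by auto
    with 7 show ?case by (intro injC) (simp_all add: V TI T.meet_commute)
  next
    case (10 a)
    with TC have "a \<in> C" by auto
    with 10 show ?case by (intro injC) (simp_all add: V TI T.join_bot)
  next
    case (11 a)
    with TC have "a \<in> C" by auto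
    with 11 show ?case by (intro injC) (simp_all add: V TI T.meet_top)
  next
    case (12 a)
    with TC Tn have "a \<in> C" "f (neg K (I a)) \<in> C" by auto
    with 12 show ?case by (intro injC) (simp_all add: V TI Tn T.join_compl)
  next
    case (13 a)
    with TC Tn have "a \<in> C" "f (neg K (I a)) \<in> C" by auto
    with 13 show ?case by (intro injC) (simp_all add: V TI Tn T.meet_compl)
  qed (simp_all add: Tp Tt Tn fT Bterm.intros)
  have am: "abelian_monoid K'"
    by (rule abelian_monoidI) (auto simp: K's V a_ac intro!: injC)
  have mo: "monoid K'"
    by (rule monoidI) (auto simp: K's V m_assoc intro!: injC)
  have sr: "semiring K'"
    by (intro semiring.intro am mo semiring_axioms.intro)
      (auto simp: K's V l_distr r_distr intro!: injC)
  have ka: "kleene_algebra K'"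
  proof (intro kleene_algebra.intro sr kleene_algebra_axioms.intro, unfold K's kle_def)
    show "x \<in> C \<Longrightarrow> f (I (Plus x x)) = x" "x \<in> C \<Longrightarrow> f (I (Star x)) \<in> C" for x
      by (auto simp: V add_idem intro!: injC)
  next
    fix x assume x: "x \<in> C"
    show "f (I (Plus (f (I (Plus (f (I One)) (f (I (Times x (f (I (Star x))))))))) (f (I (Star x))))) =
        f (I (Star x))"
      using star_unfold_left[of "I x"] x by (intro injC) (simp_all add: V kle_def)
    show "f (I (Plus (f (I (Plus (f (I One)) (f (I (Times (f (I (Star x))) x)))))) (f (I (Star x))))) =
        f (I (Star x))"
      using star_unfold_right[of "I x"] x by (intro injC) (simp_all add: V kle_def)
  next
    fix p q x
    assume a: "p \<in> C" "q \<in> C" "x \<in> C" "f (I (Plus (f (I (Plus p (f (I (Times q x)))))) x)) = x"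
    have "I p \<oplus>\<^bsub>K\<^esub> I q \<otimes>\<^bsub>K\<^esub> I x \<oplus>\<^bsub>K\<^esub> I x = I x"
      using arg_cong[OF a(4), of I] a(1-3) by (simp add: V)
    then have "star K (I q) \<otimes>\<^bsub>K\<^esub> I p \<oplus>\<^bsub>K\<^esub> I x = I x"
      using star_induct_left[of "I p" "I q" "I x"] a by (simp add: kle_def CI)
    then show "f (I (Plus (f (I (Times (f (I (Star q))) p))) x)) = x"
      using a by (intro injC) (simp_all add: V)
  next
    fix p q x
    assume a: "p \<in> C" "q \<in> C" "x \<in> C" "f (I (Plus (f (I (Plus p (f (I (Times x q)))))) x)) = x"
    have "I p \<oplus>\<^bsub>K\<^esub> I x \<otimes>\<^bsub>K\<^esub> I q \<oplus>\<^bsub>K\<^esub> I x = I x"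
      using arg_cong[OF a(4), of I] a(1-3) by (simp add: V)
    then have "I p \<otimes>\<^bsub>K\<^esub> star K (I q) \<oplus>\<^bsub>K\<^esub> I x = I x"
      using star_induct_right[of "I p" "I q" "I x"] a by (simp add: kle_def CI)
    then show "f (I (Plus (f (I (Times p (f (I (Star q)))))) x)) = x"
      using a by (intro injC) (simp_all add: V)
  qed
  have "kat K'"
    by (intro kat.intro ka kat_axioms.intro) (simp_all add: K's TC bool)
  moreover have "interp P B K' (f \<circ> I)"
    unfolding interp_def
  proof (intro conjI ballI)
    show "f \<circ> I \<in> Rex P B \<rightarrow> carrier K'" by (auto simp: K'_def fC)
  next
    fix r :: "('p, 'b) kterm" assume "r \<in> Bterm B"
    then show "(f \<circ> I) (Neg r) = neg K' ((f \<circ> I) r)" by (simp add: K'_def In If sub)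
  qed (simp_all add: K'_def fT Bterm.intros Rex.intros Ip It Is If fR)
  ultimately show thesis
    by (rule that[of K' f]) (simp_all only: K's If TI Tn Vp Vt Vs Vz Vo)
qed

lemma KAT_valid_all_kats:
  fixes K :: "'k kat"
  assumes "KAT_valid P B s t" and "s \<in> Rex P B" and "t \<in> Rex P B"
    and "kat K" and "interp P B K I"
  shows "I s = I t"
proof -
  obtain K' :: "('a, 'b) kterm kat" and f
    where "kat K'" "interp P B K' (f \<circ> I)" and If: "\<And>r. r \<in> Rex P B \<Longrightarrow> I (f (I r)) = I r"
    using term_kat_factor[OF assms(4,5)] by metis
  then have "(f \<circ> I) s = (f \<circ> I) t"
    using assms(1) unfolding KAT_valid_def by blast
  then show ?thesis using If assms(2,3) by (metis comp_apply)
qed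

lemma syntactic_hom_all_kats:
  fixes K :: "'k kat"
  assumes H: "syntactic_hom P B H" and K: "kat K" and I: "interp P B K I"
  shows "interp P B K (I \<circ> H)"
proof -
  obtain K' :: "('a, 'b) kterm kat" and f
    where K': "kat K'" and fI: "interp P B K' (f \<circ> I)"
      and If: "\<And>r. r \<in> Rex P B \<Longrightarrow> I (f (I r)) = I r"
      and hom: "\<And>x. x \<in> tests K' \<Longrightarrow> I x \<in> tests K"
        "I \<zero>\<^bsub>K'\<^esub> = \<zero>\<^bsub>K\<^esub>" "I \<one>\<^bsub>K'\<^esub> = \<one>\<^bsub>K\<^esub>"
        "\<And>x y. x \<in> carrier K' \<Longrightarrow> y \<in> carrier K' \<Longrightarrow> I (x \<oplus>\<^bsub>K'\<^esub> y) = I x \<oplus>\<^bsub>K\<^esub> I y"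
        "\<And>x y. x \<in> carrier K' \<Longrightarrow> y \<in> carrier K' \<Longrightarrow> I (x \<otimes>\<^bsub>K'\<^esub> y) = I x \<otimes>\<^bsub>K\<^esub> I y"
        "\<And>x. x \<in> carrier K' \<Longrightarrow> I (star K' x) = star K (I x)"
        "\<And>x. x \<in> tests K' \<Longrightarrow> I (neg K' x) = neg K (I x)"
    using term_kat_factor[OF K I] by blast
  define J where "J = (f \<circ> I) \<circ> H"
  have J: "interp P B K' J"
    using H K' fI unfolding J_def syntactic_hom_def by blast
  have HR: "r \<in> Rex P B \<Longrightarrow> H r \<in> Rex P B" for r
    using H by (auto simp: syntactic_hom_def)
  have sub: "x \<in> Bterm B \<Longrightarrow> x \<in> Rex P B" for x using Bterm_subset_Rex by blast
  have IJ: "I (H r) = I (J r)" if "r \<in> Rex P B" for r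
    using If[OF HR[OF that]] by (simp add: J_def)
  have JC: "J r \<in> carrier K'" if "r \<in> Rex P B" for r
    using J that by (auto simp: interp_def)
  note JT = interp_Bterm_tests[OF K' J]
  have Jop: "\<And>b. b \<in> B \<Longrightarrow> J (Test b) \<in> tests K'" "J Zero = \<zero>\<^bsub>K'\<^esub>" "J One = \<one>\<^bsub>K'\<^esub>"
    "\<And>r s. r \<in> Rex P B \<Longrightarrow> s \<in> Rex P B \<Longrightarrow> J (Plus r s) = J r \<oplus>\<^bsub>K'\<^esub> J s"
    "\<And>r s. r \<in> Rex P B \<Longrightarrow> s \<in> Rex P B \<Longrightarrow> J (Times r s) = J r \<otimes>\<^bsub>K'\<^esub> J s"
    "\<And>r. r \<in> Rex P B \<Longrightarrow> J (Star r) = star K' (J r)"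
    "\<And>r. r \<in> Bterm B \<Longrightarrow> J (Neg r) = neg K' (J r)"
    using J by (auto simp: interp_def)
  have "I \<in> Rex P B \<rightarrow> carrier K" using I by (auto simp: interp_def)
  then have "I \<circ> H \<in> Rex P B \<rightarrow> carrier K" using HR by auto
  then show ?thesis
    unfolding interp_def by (simp add: IJ Rex.intros sub Jop hom JC JT)
qed

end

theory Submission
  imports Defs
begin

text \<open>An interpretation is determined by its values on atoms, so an interpretation \<open>I\<close> satisfies
  $E_H$ iff it agrees with \<open>I \<circ> H\<close> on all terms.  If \<open>I\<close> satisfies $E_H$, then \<open>E\<close> and \<open>s = t\<close> hold
  under \<open>I\<close> iff their images under \<open>H\<close> do.  Conversely, every \<open>I \<circ> H\<close> is an interpretation that
  satisfies $E_H$ by idempotence, and it satisfies an equation iff \<open>I\<close> satisfies its image.\<close>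

lemma interp_eq_on_Rex:
  assumes I: "interp P B K I" and J: "interp P B K J"
    and prog: "\<And>p. p \<in> P \<Longrightarrow> I (Prog p) = J (Prog p)"
    and test: "\<And>b. b \<in> B \<Longrightarrow> I (Test b) = J (Test b)"
    and r: "r \<in> Rex P B"
  shows "I r = J r"
proof -
  have sub: "x \<in> Bterm B \<Longrightarrow> x \<in> Rex P B" for x
    using Bterm_subset_Rex by blast
  \<comment> \<open>Boolean terms come first: the \<open>Neg\<close> rule of \<open>Rex\<close> has
    its premise in \<open>Bterm\<close>, so induction on \<open>Rex\<close> gives no hypothesis for
    that case.\<close>
  have Bterm_eq: "I x = J x" if "x \<in> Bterm B" for x
    using that by induction (use I J test in \<open>simp_all add: interp_def sub\<close>)
  show ?thesis
    using r by induction (use I J prog test in \<open>simp_all add: interp_def Bterm_eq\<close>)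
qed

theorem theorem13:
  fixes P :: "'p set" and B :: "'b set"
    and H :: "('p, 'b) kterm \<Rightarrow> ('p, 'b) kterm"
    and E :: "(('p, 'b) kterm \<times> ('p, 'b) kterm) set"
    and s t :: "('p, 'b) kterm"
    and K :: "'k kat"
  assumes "finite P" and "finite B"
    and "syntactic_hom P B H" and "idempotent_hom P B H"
    and "E \<subseteq> Rex P B \<times> Rex P B"
    and "s \<in> Rex P B" and "t \<in> Rex P B"
    and "kat K"
  shows "models_imp P B K (E \<union> E_hom P B H) s t \<longleftrightarrow>
         models_imp P B K (image_eqs H E) (H s) (H t)"
proof
  assume L: "models_imp P B K (E \<union> E_hom P B H) s t"
  show "models_imp P B K (image_eqs H E) (H s) (H t)"
    unfolding models_imp_def
  proof (intro allI impI, elim conjE)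
    fix I assume I: "interp P B K I" and sat: "\<forall>(r, r')\<in>image_eqs H E. I r = I r'"
    have HR: "H r \<in> Rex P B" if "r \<in> Rex P B" for r
      using assms(3) that by (auto simp: syntactic_hom_def)
    \<comment> \<open>Idempotence is stated for KATs over the type of terms; the transfer lemma
      carries it to \<open>K\<close>.\<close>
    have idem: "I (H r) = I (H (H r))" if "r \<in> Rex P B" for r
      using assms(4) that KAT_valid_all_kats[OF _ HR HR[OF HR] \<open>kat K\<close> I]
      by (simp add: idempotent_hom_def)
    have "interp P B K (I \<circ> H)"
      by (rule syntactic_hom_all_kats[OF assms(3) \<open>kat K\<close> I])
    \<comment> \<open>For \<open>E\<close> this is \<open>sat\<close>; for
      \<open>E_hom P B H\<close> it is \<open>idem\<close> at an atom.\<close>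
    moreover have "\<forall>(r, r')\<in>E \<union> E_hom P B H. (I \<circ> H) r = (I \<circ> H) r'"
      using sat idem by (auto simp: image_eqs_def E_hom_def Rex.intros)
    ultimately have "(I \<circ> H) s = (I \<circ> H) t"
      using L unfolding models_imp_def by blast
    then show "I (H s) = I (H t)" by simp
  qed
next
  assume R: "models_imp P B K (image_eqs H E) (H s) (H t)"
  show "models_imp P B K (E \<union> E_hom P B H) s t"
    unfolding models_imp_def
  proof (intro allI impI, elim conjE)
    fix I assume I: "interp P B K I" and sat: "\<forall>(r, r')\<in>E \<union> E_hom P B H. I r = I r'"
    \<comment> \<open>The equations of \<open>E_hom P B H\<close> say exactly that \<open>I\<close>
      and \<open>I \<circ> H\<close> agree on atoms.\<close>
    have "I r = (I \<circ> H) r" if "r \<in> Rex P B" for r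
      by (rule interp_eq_on_Rex[OF I syntactic_hom_all_kats[OF assms(3) \<open>kat K\<close> I] _ _ that])
        (use sat in \<open>auto simp: E_hom_def\<close>)
    then have agree: "I (H r) = I r" if "r \<in> Rex P B" for r
      using that by simp
    have "I (H r) = I (H r')" if "(r, r') \<in> E" for r r'
    proof -
      have "r \<in> Rex P B" "r' \<in> Rex P B" using that assms(5) by auto
      moreover have "I r = I r'" using that sat by blast
      ultimately show ?thesis by (simp add: agree)
    qed
    then have "\<forall>(r, r')\<in>image_eqs H E. I r = I r'"
      by (auto simp: image_eqs_def)
    then have "I (H s) = I (H t)"
      using R I unfolding models_imp_def by blast
    then show "I s = I t"
      using assms(6,7) by (simp add: agree)
  qed
qed

end
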